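(* Let $(\mathcal{C},\varphi)$ be a $*$-probability space and let $a,b\in\mathcal{C}$ be such that $\mathcal{A}_a\prec\mathring{\mathcal{A}}_b$, where $\mathcal{A}_a$ is the (not necessarily unital) $*$-algebra generated by $a$ and $\mathring{\mathcal{A}}_b$ is the $*$-algebra generated by $b$ and $1$. Let $p=ab+ba$ and $q=i(ab-ba)$. Then for every integer $k\geq 1$, $$\varphi(p^k)=\frac{1}{2\sqrt{\varphi(b^2)}}\left([\varphi(b)+\sqrt{\varphi(b^2)}]^{k+1}-[\varphi(b)-\sqrt{\varphi(b^2)}]^{k+1}\right)\varphi(a^k)$$ and $$\varphi(q^k)=\frac12\left(1-(-1)^{k+1}\right)\left(\sqrt{\varphi(b^2)-\varphi(b)^2}\right)^k\varphi(a^k).$$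
   Context: A $*$-probability space is a pair $(\mathcal{C},\varphi)$ where $\mathcal{C}$ is a unital complex $*$-algebra and $\varphi:\mathcal{C}\to\mathbb{C}$ is linear with $\varphi(1)=1$ and $\varphi(c^*c)\geq 0$ for all $c\in\mathcal{C}$. For $*$-subalgebras $\mathcal{A},\mathcal{B}$ of $\mathcal{C}$ (not necessarily unital), $(\mathcal{A},\mathcal{B})$ is monotone independent, written $\mathcal{A}\prec\mathcal{B}$, if $$\varphi(b_0a_1b_1\cdots a_nb_n)=\varphi(a_1\cdots a_n)\varphi(b_0)\varphi(b_1)\cdots\varphi(b_n)$$ for all $n\ge 1$, $a_1,\dots,a_n\in\mathcal{A}$, $b_1,\dots,b_{n-1}\in\mathcal{B}$, and $b_0,b_n$ each either $1$ or an element of $\mathcal{B}$. *)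

theory Defs
  imports Complex_Main "HOL-Library.Nonpos_Ints"
begin

text \<open>
  The underlying unital ring comes from the type class. That class demands \<open>0 \<noteq> 1\<close>, which
  excludes no \<open>*\<close>-probability space, since there \<open>\<phi> 1 = 1\<close> and \<open>\<phi> 0 = 0\<close>.
\<close>

locale star_algebra = vector_space scale
  for scale :: "complex \<Rightarrow> 'a::ring_1 \<Rightarrow> 'a" +
  fixes star :: "'a \<Rightarrow> 'a"
  assumes scale_mult_left: "scale c x * y = scale c (x * y)"
    and scale_mult_right: "x * scale c y = scale c (x * y)"
    and star_star: "star (star x) = x"
    and star_add: "star (x + y) = star x + star y"
    and star_scale: "star (scale c x) = scale (cnj c) (star x)"
    and star_mult: "star (x * y) = star y * star x"
begin

text \<open>Subalgebras are not required to contain \<open>1\<close>.\<close>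

definition star_subalgebra :: "'a set \<Rightarrow> bool" where
  "star_subalgebra S \<longleftrightarrow>
     subspace S \<and> (\<forall>x\<in>S. \<forall>y\<in>S. x * y \<in> S) \<and> (\<forall>x\<in>S. star x \<in> S)"

definition star_algebra_generated_by :: "'a set \<Rightarrow> 'a set" where
  "star_algebra_generated_by X = star_subalgebra hull X"

end

locale star_prob_space = star_algebra scale star
  for scale :: "complex \<Rightarrow> 'a::ring_1 \<Rightarrow> 'a" and star :: "'a \<Rightarrow> 'a" +
  fixes \<phi> :: "'a \<Rightarrow> complex"
  assumes linear_phi: "Vector_Spaces.linear scale (*) \<phi>"
    and phi_one: "\<phi> 1 = 1"
    and phi_nonneg: "\<phi> (star c * c) \<in> \<real>\<^sub>\<ge>\<^sub>0"
begin

text \<open>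
  The sequences \<open>x\<close> and \<open>y\<close> hold \<open>a\<^sub>1, \<dots>, a\<^sub>n\<close> and \<open>b\<^sub>0, \<dots>, b\<^sub>n\<close>; products in the algebra are
  taken over lists because it need not be commutative.
\<close>

definition monotone_independent :: "'a set \<Rightarrow> 'a set \<Rightarrow> bool" where
  "monotone_independent A B \<longleftrightarrow>
     (\<forall>n\<ge>1. \<forall>x y :: nat \<Rightarrow> 'a.
        (\<forall>i\<in>{1..n}. x i \<in> A) \<longrightarrow> (\<forall>i\<in>{1..<n}. y i \<in> B) \<longrightarrow>
        y 0 \<in> insert 1 B \<longrightarrow> y n \<in> insert 1 B \<longrightarrow>
        \<phi> (y 0 * prod_list (map (\<lambda>i. x i * y i) [1..<n+1])) =
          \<phi> (prod_list (map x [1..<n+1])) * (\<Prod>i\<in>{0..n}. \<phi> (y i)))"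

end

end

theory Submission imports Defs begin

text \<open>
  Let \<open>m = \<phi> b\<close> and \<open>v = \<phi> (b\<^sup>2)\<close>. Multiplying a word \<open>y\<^sub>0 a y\<^sub>1 \<cdots> a y\<^sub>n\<close> on the right by
  \<open>s a b + t b a\<close> yields two words of the same kind, one ending in \<open>\<dots> y\<^sub>n a b\<close>, the other in
  \<open>\<dots> (y\<^sub>n b) a 1\<close>. By monotone independence the moment of a word times \<open>(s a b + t b a)^k\<close>
  therefore depends on the last letter only through \<open>\<alpha>\<^sub>k \<phi> y\<^sub>n + \<beta>\<^sub>k \<phi> (y\<^sub>n b)\<close>, where
  \<open>\<alpha>\<^bsub>k+1\<^esub> = s (m \<alpha>\<^sub>k + v \<beta>\<^sub>k)\<close> and \<open>\<beta>\<^bsub>k+1\<^esub> = t (\<alpha>\<^sub>k + m \<beta>\<^sub>k)\<close>. The empty word gives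
  \<open>\<phi> ((s a b + t b a)^k) = (\<alpha>\<^sub>k + m \<beta>\<^sub>k) \<phi> (a^k)\<close>, and both claims follow by solving this
  linear recursion.
\<close>

text \<open>The recursion grows at the right end, where further factors are multiplied on.\<close>

fun alternating_word :: "'a::monoid_mult \<Rightarrow> (nat \<Rightarrow> 'a) \<Rightarrow> nat \<Rightarrow> 'a" where
  "alternating_word a y 0 = y 0"
| "alternating_word a y (Suc n) = alternating_word a y n * (a * y (Suc n))"

lemma alternating_word_eq_prod_list:
  "alternating_word a y n = y 0 * prod_list (map (\<lambda>i. a * y i) [1..<n+1])"
  by (induction n) (simp_all add: mult.assoc)

lemma alternating_word_cong:
  "(\<And>i. i \<le> n \<Longrightarrow> y i = z i) \<Longrightarrow> alternating_word a y n = alternating_word a z n"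
  by (induction n) auto

lemma alternating_word_update_last:
  "alternating_word a (y(n := y n * c)) n = alternating_word a y n * c"
proof (cases n)
  case (Suc j)
  have "alternating_word a (y(n := y n * c)) j = alternating_word a y j"
    by (rule alternating_word_cong) (simp add: Suc)
  then show ?thesis
    by (simp add: Suc mult.assoc)
qed simp

fun moment_coeffs :: "complex \<Rightarrow> complex \<Rightarrow> complex \<Rightarrow> complex \<Rightarrow> nat \<Rightarrow> complex \<times> complex" where
  "moment_coeffs s t m v 0 = (1, 0)"
| "moment_coeffs s t m v (Suc k) =
    (let (\<alpha>, \<beta>) = moment_coeffs s t m v k in (s * (m * \<alpha> + v * \<beta>), t * (\<alpha> + m * \<beta>)))"

text \<open>The row vector \<open>(1, r)\<close> is a left eigenvector of the step matrix with rows
  \<open>(m, v)\<close> and \<open>(1, m)\<close>, with eigenvalue \<open>m + r\<close>. Either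
  square root \<open>r\<close> of \<open>v\<close> is allowed.\<close>

lemma moment_coeffs_anticommutator:
  assumes "moment_coeffs 1 1 m v k = (\<alpha>, \<beta>)" "r\<^sup>2 = v"
  shows "\<alpha> + r * \<beta> = (m + r) ^ k"
  using assms
proof (induction k arbitrary: \<alpha> \<beta>)
  case (Suc k)
  obtain \<alpha>' \<beta>' where k: "moment_coeffs 1 1 m v k = (\<alpha>', \<beta>')"
    by force
  have "\<alpha> + r * \<beta> = (m + r) * (\<alpha>' + r * \<beta>')"
    using Suc.prems k by (auto simp: algebra_simps power2_eq_square)
  then show ?case
    using Suc.IH[OF k Suc.prems(2)] by simp
qed simp

text \<open>The step matrix now has trace 0 and determinant \<open>m\<^sup>2 - v\<close>, so its
  square is \<open>d\<^sup>2\<close> times the identity: two steps only rescale the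
  coefficients.\<close>

lemma moment_coeffs_commutator:
  assumes "d\<^sup>2 = v - m\<^sup>2"
  shows "moment_coeffs \<i> (- \<i>) m v k =
    (if even k then (d ^ k, 0) else (\<i> * m * d ^ (k - 1), - \<i> * d ^ (k - 1)))"
proof (induction k)
  case (Suc k)
  show ?case
  proof (cases "even k")
    case False
    then obtain j where j: "k = Suc j"
      using not0_implies_Suc odd_pos by blast
    have "v = d\<^sup>2 + m\<^sup>2"
      using assms by simp
    then show ?thesis
      using Suc False j by (auto simp: algebra_simps power2_eq_square)
  qed (use Suc in \<open>auto simp: algebra_simps\<close>)
qed simp

context star_algebra
begin

lemma generated_by_superset: "X \<subseteq> star_algebra_generated_by X"
  unfolding star_algebra_generated_by_def by (rule hull_subset)

lemma generated_by_mult: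
  assumes "x \<in> star_algebra_generated_by X" "y \<in> star_algebra_generated_by X"
  shows "x * y \<in> star_algebra_generated_by X"
  using assms unfolding star_algebra_generated_by_def hull_def star_subalgebra_def by blast

end

context star_prob_space
begin

lemma phi_add: "\<phi> (x + y) = \<phi> x + \<phi> y"
  and phi_scale: "\<phi> (scale c x) = c * \<phi> x"
  using linear_phi by (simp_all add: module_hom_iff_linear[symmetric] module_hom.add module_hom.scale)

lemma phi_alternating_word:
  assumes indep: "monotone_independent A B" and "a \<in> A" and y: "\<And>i. i \<le> n \<Longrightarrow> y i \<in> B"
  shows "\<phi> (alternating_word a y n) = \<phi> (a ^ n) * (\<Prod>i\<le>n. \<phi> (y i))"
\<comment> \<open>Independence covers only \<open>n \<ge> 1\<close>; for \<open>n = 0\<close> both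
  sides are \<open>\<phi> (y 0)\<close>.\<close>
proof (cases "n = 0")
  case False
  have "\<phi> (alternating_word a y n) =
      \<phi> (prod_list (map (\<lambda>_. a) [1..<n+1])) * (\<Prod>i\<in>{0..n}. \<phi> (y i))"
    using indep[unfolded monotone_independent_def, rule_format, of n "\<lambda>_. a" y] False assms
    by (simp add: alternating_word_eq_prod_list)
  also have "prod_list (map (\<lambda>_. a) [1..<n+1]) = a ^ n"
    by (simp add: map_replicate_const del: upt_Suc)
  finally show ?thesis
    by (simp add: atLeast0AtMost)
qed (simp add: phi_one)

lemma phi_alternating_word_mult_power:
  assumes indep: "monotone_independent A B" and a: "a \<in> A" and b: "b \<in> B" and one: "1 \<in> B"
    and mult: "\<And>x y. x \<in> B \<Longrightarrow> y \<in> B \<Longrightarrow> x * y \<in> B"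
    and y: "\<And>i. i \<le> n \<Longrightarrow> y i \<in> B"
    and coeffs: "moment_coeffs s t (\<phi> b) (\<phi> (b\<^sup>2)) k = (\<alpha>, \<beta>)"
  shows "\<phi> (alternating_word a y n * (scale s (a * b) + scale t (b * a)) ^ k) =
    \<phi> (a ^ (n + k)) * (\<Prod>i<n. \<phi> (y i)) * (\<alpha> * \<phi> (y n) + \<beta> * \<phi> (y n * b))"
  using y coeffs
\<comment> \<open>Each factor moved into the word lengthens it and may alter its last letter, so
  \<open>n\<close> and \<open>y\<close> must vary.\<close>
proof (induction k arbitrary: n y \<alpha> \<beta>)
  case 0
  then show ?case
    using phi_alternating_word[OF indep a, of n y] by (simp add: lessThan_Suc_atMost[symmetric])
next
  case (Suc k)
  let ?p = "scale s (a * b) + scale t (b * a)"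
  obtain \<alpha>' \<beta>' where k: "moment_coeffs s t (\<phi> b) (\<phi> (b\<^sup>2)) k = (\<alpha>', \<beta>')"
    by force
  \<comment> \<open>In \<open>y1\<close> the \<open>b\<close> of \<open>a * b\<close> is the new
    last letter. In \<open>y2\<close> the \<open>b\<close> of \<open>b * a\<close> is absorbed by
    the old last letter, and \<open>1\<close> closes the word.\<close>
  define y1 where "y1 = y(Suc n := b)"
  define y2 where "y2 = y(n := y n * b, Suc n := 1)"
  have w1: "alternating_word a y1 (Suc n) = alternating_word a y n * (a * b)"
    unfolding y1_def by (simp cong: alternating_word_cong)
  have "alternating_word a y2 n = alternating_word a (y(n := y n * b)) n"
    unfolding y2_def by (rule alternating_word_cong) simp
  then have w2: "alternating_word a y2 (Suc n) = alternating_word a y n * (b * a)"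
    by (simp add: alternating_word_update_last mult.assoc) (simp add: y2_def)
  have split: "alternating_word a y n * ?p ^ Suc k =
      scale s (alternating_word a y1 (Suc n) * ?p ^ k) +
      scale t (alternating_word a y2 (Suc n) * ?p ^ k)"
    unfolding w1 w2 by (simp add: algebra_simps scale_mult_left scale_mult_right)
  have y1: "y1 i \<in> B" and y2: "y2 i \<in> B" if "i \<le> Suc n" for i
    using that Suc.prems(1) b one mult by (auto simp: y1_def y2_def)
  have prods: "(\<Prod>i<Suc n. \<phi> (y1 i)) = (\<Prod>i<n. \<phi> (y i)) * \<phi> (y n)"
    "(\<Prod>i<Suc n. \<phi> (y2 i)) = (\<Prod>i<n. \<phi> (y i)) * \<phi> (y n * b)"
    by (simp_all add: y1_def y2_def)
  have last: "y1 (Suc n) = b" "y2 (Suc n) = 1"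
    by (simp_all add: y1_def y2_def)
  have word1: "\<phi> (alternating_word a y1 (Suc n) * ?p ^ k) =
      \<phi> (a ^ (n + Suc k)) * (\<Prod>i<n. \<phi> (y i)) * \<phi> (y n) * (\<alpha>' * \<phi> b + \<beta>' * \<phi> (b\<^sup>2))"
    using Suc.IH[of "Suc n" y1, OF y1 k] unfolding prods last
    by (simp add: power2_eq_square del: alternating_word.simps)
  have word2: "\<phi> (alternating_word a y2 (Suc n) * ?p ^ k) =
      \<phi> (a ^ (n + Suc k)) * (\<Prod>i<n. \<phi> (y i)) * \<phi> (y n * b) * (\<alpha>' + \<beta>' * \<phi> b)"
    using Suc.IH[of "Suc n" y2, OF y2 k] unfolding prods last
    by (simp add: phi_one del: alternating_word.simps)
  have step: "\<alpha> = s * (\<phi> b * \<alpha>' + \<phi> (b\<^sup>2) * \<beta>')" "\<beta> = t * (\<alpha>' + \<phi> b * \<beta>')"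
    using Suc.prems(2) k by auto
  show ?case
    unfolding split phi_add phi_scale word1 word2 step by (simp add: algebra_simps)
qed

text \<open>Covers \<open>p\<close> with \<open>s = t = 1\<close> and \<open>q\<close> with
  \<open>s = \<i>\<close>, \<open>t = - \<i>\<close>. It starts from the one-letter word
  \<open>1\<close>.\<close>

lemma phi_power_bilinear:
  assumes indep: "monotone_independent (star_algebra_generated_by {a})
      (star_algebra_generated_by {b, 1})"
    and coeffs: "moment_coeffs s t (\<phi> b) (\<phi> (b\<^sup>2)) k = (\<alpha>, \<beta>)"
  shows "\<phi> ((scale s (a * b) + scale t (b * a)) ^ k) = (\<alpha> + \<phi> b * \<beta>) * \<phi> (a ^ k)"
proof -
  have "a \<in> star_algebra_generated_by {a}" "b \<in> star_algebra_generated_by {b, 1}"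
    "1 \<in> star_algebra_generated_by {b, 1}"
    using generated_by_superset by blast+
  from phi_alternating_word_mult_power[OF indep this generated_by_mult _ coeffs,
      where n = 0 and y = "\<lambda>_. 1"] this
  show ?thesis
    by (simp add: phi_one algebra_simps)
qed

end

theorem corollary3p3:
  fixes scale :: "complex \<Rightarrow> 'a::ring_1 \<Rightarrow> 'a"
    and star :: "'a \<Rightarrow> 'a"
    and \<phi> :: "'a \<Rightarrow> complex"
    and a b p q :: 'a
    and k :: nat
  assumes "star_prob_space scale star \<phi>"
    and "star_prob_space.monotone_independent \<phi>
           (star_algebra.star_algebra_generated_by scale star {a})
           (star_algebra.star_algebra_generated_by scale star {b, 1})"
    and "p = a * b + b * a"
    and "q = scale \<i> (a * b - b * a)"
    and "k \<ge> 1"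
  shows "(\<phi> (b^2) \<noteq> 0 \<longrightarrow>
            \<phi> (p^k) = 1 / (2 * csqrt (\<phi> (b^2))) *
              ((\<phi> b + csqrt (\<phi> (b^2)))^(k+1) - (\<phi> b - csqrt (\<phi> (b^2)))^(k+1)) * \<phi> (a^k)) \<and>
         \<phi> (q^k) = 1/2 * (1 - (-1)^(k+1)) * (csqrt (\<phi> (b^2) - (\<phi> b)^2))^k * \<phi> (a^k)"
proof -
  interpret star_prob_space scale star \<phi>
    by (rule assms(1))
  let ?m = "\<phi> b" and ?v = "\<phi> (b\<^sup>2)"
  note moment = phi_power_bilinear[OF assms(2)]
  have "\<phi> (p ^ k) = 1 / (2 * csqrt ?v) *
      ((?m + csqrt ?v) ^ (k + 1) - (?m - csqrt ?v) ^ (k + 1)) * \<phi> (a ^ k)" if "?v \<noteq> 0"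
  proof -
    let ?r = "csqrt ?v"
    obtain \<alpha> \<beta> where c: "moment_coeffs 1 1 ?m ?v k = (\<alpha>, \<beta>)"
      by force
    have plus: "\<alpha> + ?r * \<beta> = (?m + ?r) ^ k"
      by (rule moment_coeffs_anticommutator[OF c]) simp
    have minus: "\<alpha> - ?r * \<beta> = (?m - ?r) ^ k"
      using moment_coeffs_anticommutator[OF c, of "- ?r"] by simp
    \<comment> \<open>The right side is \<open>(?m + ?r) * (\<alpha> + ?r * \<beta>) - (?m - ?r) *
      (\<alpha> - ?r * \<beta>)\<close>, where the terms in \<open>?m * \<alpha>\<close> and
      \<open>?r\<^sup>2 * \<beta>\<close> cancel.\<close>
    have "2 * ?r * (\<alpha> + ?m * \<beta>) = (?m + ?r) ^ (k + 1) - (?m - ?r) ^ (k + 1)"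
      by (simp add: plus[symmetric] minus[symmetric] algebra_simps)
    then have "\<alpha> + ?m * \<beta> = 1 / (2 * ?r) * ((?m + ?r) ^ (k + 1) - (?m - ?r) ^ (k + 1))"
      using that by (simp add: field_simps)
    moreover have "p = scale 1 (a * b) + scale 1 (b * a)"
      by (simp add: assms(3))
    ultimately show ?thesis
      using moment[OF c] by simp
  qed
  moreover have "\<phi> (q ^ k) =
      1/2 * (1 - (-1) ^ (k + 1)) * (csqrt (?v - ?m\<^sup>2)) ^ k * \<phi> (a ^ k)"
  proof -
    let ?d = "csqrt (?v - ?m\<^sup>2)"
    obtain \<alpha> \<beta> where c: "moment_coeffs \<i> (- \<i>) ?m ?v k = (\<alpha>, \<beta>)"
      by force
    \<comment> \<open>For odd \<open>k\<close> the two summands on the left cancel, and the sign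
      factor is 0; for even \<open>k\<close> only \<open>\<alpha> = ?d ^ k\<close> remains.\<close>
    have "\<alpha> + ?m * \<beta> = 1/2 * (1 - (-1) ^ (k + 1)) * ?d ^ k"
      using c moment_coeffs_commutator[of ?d ?v ?m k] by (auto split: if_splits)
    moreover have "q = scale \<i> (a * b) + scale (- \<i>) (b * a)"
      by (simp add: assms(4) scale_right_diff_distrib)
    ultimately show ?thesis
      using moment[OF c] by simp
  qed
  ultimately show ?thesis
    by blast
qed

end
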